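(* Let $\{x_n\}$ be a sequence of real numbers converging to $\alpha\in\mathbb{R}$, generated by a one-point iterative method with memory for a nonlinear equation $f(x)=0$ with root $\alpha$. Let $e_n=x_n-\alpha$, with $e_n\neq 0$, and suppose that $$|e_{n+1}| = |C|\,|e_n|^{\rho}\,\bigl(1+O(|e_n|^{\sigma})\bigr)\qquad (n\to\infty),$$ where $C\neq 0$ is a real constant, $0<\sigma<1$ and $\rho\ge (1+\sqrt5)/2$ (so $\rho$ is the order of convergence). Let $\widehat{e}_n=x_n-x_{n-1}$ and let $$\widehat{\lambda}_n=\frac{\log|\widehat{e}_n|}{\log|\widehat{e}_{n-1}|}$$ be the approximated computational local order of convergence (ACLOC). Then, as $n\to\infty$, $$\widehat{\lambda}_n=\rho\left(1+O\!\left(\frac{\log|C|}{\rho\,\log|e_{n-2}|}\right)\right).$$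
   Context: A one-point iterative method with memory for solving $f(x)=0$, where $f:I\subseteq\mathbb{R}\to\mathbb{R}$ and $I$ is a neighborhood of the root $\alpha$, is an iteration $x_{n+1}=\phi(x_n;x_{n-1},\dots,x_{n-j})$, $n\ge 0$, where $\phi$ is the iteration function; the case without memory ($j=0$) is allowed. The quantity $\widehat{\lambda}_n$ is considered for iterates near the root, i.e. for $n$ large enough.
   Formalization: For |C| = 1 the stated error term is O(0), which would force the ACLOC to equal ρ exactly and fails for x_{n+1} = x_n^2 (α = 0, ρ = 2, C = 1); in that case the bound proved is O(1/(ρ log|e_{n-2}|)) instead. *)

theory Defs
  imports "HOL-Analysis.Analysis" "HOL-Library.Landau_Symbols"
begin

text \<open>
  The iteration function \<open>\<phi>\<close> receives the current iterate and the list of the \<open>j\<close> previous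
  ones, most recent first; \<open>j = 0\<close> is the case without memory. The numbering is shifted so
  that the starting values are \<open>x 0, \<dots>, x j\<close> (instead of having indices from \<open>-j\<close> to \<open>0\<close>).
\<close>

definition one_point_iteration ::
    "nat \<Rightarrow> (real \<Rightarrow> real list \<Rightarrow> real) \<Rightarrow> (nat \<Rightarrow> real) \<Rightarrow> bool" where
  "one_point_iteration j \<phi> x \<longleftrightarrow>
     (\<forall>n\<ge>j. x (Suc n) = \<phi> (x n) (map (\<lambda>i. x (n - i)) [1..<Suc j]))"

text \<open>
  The approximated computational local order of convergence. It is meaningful for \<open>n \<ge> 2\<close>
  only; for smaller \<open>n\<close> the subtraction on the indices truncates.
\<close>

definition ehat :: "(nat \<Rightarrow> real) \<Rightarrow> nat \<Rightarrow> real" where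
  "ehat x n = x n - x (n - 1)"

definition ACLOC :: "(nat \<Rightarrow> real) \<Rightarrow> nat \<Rightarrow> real" where
  "ACLOC x n = ln \<bar>ehat x n\<bar> / ln \<bar>ehat x (n - 1)\<bar>"

end

theory Submission
  imports Defs
begin

text \<open>
  On a logarithmic scale the error law is linear: with \<open>L n = ln \<bar>e n\<bar>\<close>, which tends to \<open>-\<infinity>\<close>,
  it reads \<open>L (n + 1) = \<rho> L n + O(1)\<close>, where the bounded term is \<open>ln \<bar>C\<bar> + ln (1 + \<epsilon> n)\<close>
  (\<open>log_error_recurrence\<close>). Since \<open>\<rho> > 1\<close>, the gaps \<open>L (n + 1) - L n\<close> also tend to \<open>-\<infinity>\<close>,
  so \<open>e (n + 1)\<close> is negligible against \<open>e n\<close> (\<open>error_ratio_tendsto_0\<close>), and the logarithm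
  \<open>a n\<close> of the step \<open>\<bar>x (n + 1) - x n\<bar> = \<bar>e (n + 1) - e n\<bar>\<close> is \<open>L n + o(1)\<close>
  (\<open>log_difference_tendsto\<close>). Hence the steps satisfy the same law
  \<open>a (n + 1) = \<rho> a n + O(1)\<close>, and dividing it by \<open>a n\<close>, which is asymptotic to \<open>L n\<close>, gives
  \<open>a (n + 1) / a n = \<rho> + O(1 / L n)\<close> (\<open>quotient_of_perturbed_recurrence\<close>).

  The left-hand side is the ACLOC at index \<open>n + 2\<close>, which is why \<open>e (n - 2)\<close> occurs in the
  conclusion. The factors \<open>ln \<bar>C\<bar>\<close> (when it is nonzero) and \<open>1 / \<rho>\<close> are constants, which the
  Landau symbol absorbs.
\<close>

lemma log_error_recurrence:
  fixes e \<epsilon> :: "nat \<Rightarrow> real"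
  assumes nz: "\<And>n. e n \<noteq> 0" and "C \<noteq> 0" and eps: "\<epsilon> \<longlonglongrightarrow> 0"
    and law: "\<forall>\<^sub>F n in sequentially. \<bar>e (Suc n)\<bar> = \<bar>C\<bar> * \<bar>e n\<bar> powr \<rho> * (1 + \<epsilon> n)"
  shows "(\<lambda>n. ln \<bar>e (Suc n)\<bar> - \<rho> * ln \<bar>e n\<bar>) \<longlonglongrightarrow> ln \<bar>C\<bar>"
proof (rule Lim_transform_eventually)
  have "(\<lambda>n. ln \<bar>C\<bar> + ln (1 + \<epsilon> n)) \<longlonglongrightarrow> ln \<bar>C\<bar> + ln (1 + 0)"
    by (intro tendsto_intros eps) auto
  then show "(\<lambda>n. ln \<bar>C\<bar> + ln (1 + \<epsilon> n)) \<longlonglongrightarrow> ln \<bar>C\<bar>"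
    by simp
  have "\<forall>\<^sub>F n in sequentially. \<epsilon> n > -1"
    using order_tendstoD(1)[OF eps, of "-1"] by simp
  with law show "\<forall>\<^sub>F n in sequentially.
      ln \<bar>C\<bar> + ln (1 + \<epsilon> n) = ln \<bar>e (Suc n)\<bar> - \<rho> * ln \<bar>e n\<bar>"
  proof eventually_elim
    case (elim n)
    then show ?case
      using \<open>C \<noteq> 0\<close> nz[of n] by (simp add: ln_mult ln_powr)
  qed
qed

text \<open>
  This is where superlinear convergence enters: for \<open>\<rho> = 1\<close> the ratio would tend to
  \<open>exp c\<close> in absolute value, and consecutive errors would be of the same size.
\<close>

lemma error_ratio_tendsto_0:
  fixes e :: "nat \<Rightarrow> real"
  assumes nz: "\<And>n. e n \<noteq> 0" and "\<rho> > 1"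
    and bot: "filterlim (\<lambda>n. ln \<bar>e n\<bar>) at_bot sequentially"
    and rec: "(\<lambda>n. ln \<bar>e (Suc n)\<bar> - \<rho> * ln \<bar>e n\<bar>) \<longlonglongrightarrow> c"
  shows "(\<lambda>n. e (Suc n) / e n) \<longlonglongrightarrow> 0"
proof -
  have "filterlim (\<lambda>n. (\<rho> - 1) * ln \<bar>e n\<bar>) at_bot sequentially"
    using \<open>\<rho> > 1\<close> by (intro filterlim_tendsto_pos_mult_at_bot[OF tendsto_const _ bot]) simp
  from filterlim_tendsto_add_at_bot_iff[THEN iffD2, OF rec this]
  have gap: "filterlim (\<lambda>n. ln \<bar>e (Suc n)\<bar> - ln \<bar>e n\<bar>) at_bot sequentially"
    by (simp add: algebra_simps)
  have "(\<lambda>n. exp (ln \<bar>e (Suc n)\<bar> - ln \<bar>e n\<bar>)) \<longlonglongrightarrow> 0"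
    by (rule filterlim_compose[OF exp_at_bot gap])
  then have "(\<lambda>n. \<bar>e (Suc n) / e n\<bar>) \<longlonglongrightarrow> 0"
    by (simp add: exp_diff nz)
  then show ?thesis
    by (rule tendsto_rabs_zero_cancel)
qed

text \<open>
  The logarithm turns the factorization \<open>e (n + 1) - e n = - e n (1 - e (n + 1) / e n)\<close> into a
  sum whose second term vanishes in the limit.
\<close>

lemma log_difference_tendsto:
  fixes e :: "nat \<Rightarrow> real"
  assumes nz: "\<And>n. e n \<noteq> 0" and ratio: "(\<lambda>n. e (Suc n) / e n) \<longlonglongrightarrow> 0"
  shows "(\<lambda>n. ln \<bar>e (Suc n) - e n\<bar> - ln \<bar>e n\<bar>) \<longlonglongrightarrow> 0"
proof (rule Lim_transform_eventually)
  have "(\<lambda>n. ln (1 - e (Suc n) / e n)) \<longlonglongrightarrow> ln (1 - 0)"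
    by (intro tendsto_intros ratio) auto
  then show "(\<lambda>n. ln (1 - e (Suc n) / e n)) \<longlonglongrightarrow> 0"
    by simp
  have "\<forall>\<^sub>F n in sequentially. e (Suc n) / e n < 1"
    using order_tendstoD(2)[OF ratio, of 1] by simp
  then show "\<forall>\<^sub>F n in sequentially.
      ln (1 - e (Suc n) / e n) = ln \<bar>e (Suc n) - e n\<bar> - ln \<bar>e n\<bar>"
  proof eventually_elim
    case (elim n)
    have "\<bar>e (Suc n) - e n\<bar> = \<bar>e n * (1 - e (Suc n) / e n)\<bar>"
      using nz[of n] by (simp add: right_diff_distrib abs_minus_commute)
    also have "\<dots> = \<bar>e n\<bar> * (1 - e (Suc n) / e n)"
      using elim by (simp add: abs_mult)
    finally have "ln \<bar>e (Suc n) - e n\<bar> = ln (\<bar>e n\<bar> * (1 - e (Suc n) / e n))"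
      by simp
    also have "\<dots> = ln \<bar>e n\<bar> + ln (1 - e (Suc n) / e n)"
      using elim nz[of n] by (intro ln_mult_pos) simp_all
    finally show ?case
      by simp
  qed
qed

text \<open>
  A perturbation \<open>a - L\<close> that tends to \<open>0\<close> preserves the recurrence up to a bounded term, and
  it preserves the size of the denominator because
  \<open>L\<close> tends to \<open>-\<infinity>\<close>. The numerator of \<open>a (n + 1) / a n - \<rho> = (a (n + 1) - \<rho> a n) / a n\<close>
  converges and is therefore bounded, which leaves the order \<open>1 / a n\<close> of the denominator.
\<close>

lemma quotient_of_perturbed_recurrence:
  fixes a L :: "nat \<Rightarrow> real"
  assumes bot: "filterlim L at_bot sequentially"
    and rec: "(\<lambda>n. L (Suc n) - \<rho> * L n) \<longlonglongrightarrow> c"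
    and close: "(\<lambda>n. a n - L n) \<longlonglongrightarrow> 0"
  shows "(\<lambda>n. a (Suc n) / a n - \<rho>) \<in> O(\<lambda>n. 1 / L n)"
proof -
  have a_bot: "filterlim a at_bot sequentially"
    using filterlim_tendsto_add_at_bot_iff[THEN iffD2, OF close bot] by simp
  have "(\<lambda>n. (a (Suc n) - L (Suc n)) - \<rho> * (a n - L n) + (L (Suc n) - \<rho> * L n))
      \<longlonglongrightarrow> 0 - \<rho> * 0 + c"
    by (intro tendsto_intros close rec LIMSEQ_Suc[OF close])
  then have "(\<lambda>n. a (Suc n) - \<rho> * a n) \<longlonglongrightarrow> c"
    by (simp add: algebra_simps)
  then have num: "(\<lambda>n. a (Suc n) - \<rho> * a n) \<in> O(\<lambda>_. 1)"
    by (intro bigoI_tendsto[where c = c]) auto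
  have "((\<lambda>n. (a n - L n) / L n) \<longlongrightarrow> 0) sequentially"
    by (rule tendsto_divide_0[OF close filterlim_at_bot_imp_at_infinity[OF bot]])
  then have "(\<lambda>n. (a n - L n)) \<in> o(L)"
    using filterlim_at_bot_dense[THEN iffD1, OF bot, rule_format, of 0]
    by (intro smalloI_tendsto) (auto elim: eventually_mono)
  then have "a \<sim>[sequentially] L"
    by (rule smallo_imp_asymp_equiv)
  then have "L \<in> \<Theta>(a)"
    by (metis asymp_equiv_imp_bigtheta bigtheta_sym)
  then have "(\<lambda>n. 1 / a n) \<in> O(\<lambda>n. 1 / L n)"
    by (simp add: bigthetaD2 bigtheta_divide bigthetaD1 bigtheta_sym)
  from landau_o.big.mult[OF num this]
  have "(\<lambda>n. (a (Suc n) - \<rho> * a n) / a n) \<in> O(\<lambda>n. 1 / L n)"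
    by simp
  moreover have "\<forall>\<^sub>F n in sequentially. (a (Suc n) - \<rho> * a n) / a n = a (Suc n) / a n - \<rho>"
    using filterlim_at_bot_dense[THEN iffD1, OF a_bot, rule_format, of 0]
    by eventually_elim (simp add: diff_divide_distrib)
  ultimately show ?thesis
    by (simp add: landau_o.big.in_cong)
qed

theorem proposition4p1:
  fixes f :: "real \<Rightarrow> real" and I :: "real set" and \<alpha> :: real
    and j :: nat and \<phi> :: "real \<Rightarrow> real list \<Rightarrow> real"
    and x e \<epsilon> :: "nat \<Rightarrow> real" and C \<rho> \<sigma> :: real
  assumes "\<alpha> \<in> interior I" and "f \<alpha> = 0"
    and "one_point_iteration j \<phi> x"
    and "x \<longlonglongrightarrow> \<alpha>"
    and "\<And>n. e n = x n - \<alpha>" and "\<And>n. e n \<noteq> 0"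
    and "C \<noteq> 0" and "0 < \<sigma>" and "\<sigma> < 1" and "\<rho> \<ge> (1 + sqrt 5) / 2"
    and "\<forall>\<^sub>F n in sequentially.
           \<bar>e (n + 1)\<bar> = \<bar>C\<bar> * \<bar>e n\<bar> powr \<rho> * (1 + \<epsilon> n)"
    and "\<epsilon> \<in> O(\<lambda>n. \<bar>e n\<bar> powr \<sigma>)"
  shows "\<exists>\<delta> :: nat \<Rightarrow> real.
           (\<forall>\<^sub>F n in sequentially. ACLOC x n = \<rho> * (1 + \<delta> n)) \<and>
           (\<bar>C\<bar> \<noteq> 1 \<longrightarrow> \<delta> \<in> O(\<lambda>n. ln \<bar>C\<bar> / (\<rho> * ln \<bar>e (n - 2)\<bar>))) \<and>
           (\<bar>C\<bar> = 1 \<longrightarrow> \<delta> \<in> O(\<lambda>n. 1 / (\<rho> * ln \<bar>e (n - 2)\<bar>)))"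
proof -
  note nz = \<open>\<And>n. e n \<noteq> 0\<close>
  have "1 < (1 + sqrt 5) / 2"
    using less_half_sum[of 1 "sqrt 5"] by simp
  also note \<open>\<rho> \<ge> (1 + sqrt 5) / 2\<close>
  finally have "\<rho> > 1" .

  have "(\<lambda>n. x n - \<alpha>) \<longlonglongrightarrow> 0"
    using \<open>x \<longlonglongrightarrow> \<alpha>\<close> by (simp add: LIM_zero_iff)
  then have e0: "(\<lambda>n. \<bar>e n\<bar>) \<longlonglongrightarrow> 0"
    using \<open>\<And>n. e n = x n - \<alpha>\<close> by (simp add: tendsto_rabs_zero_iff)
  then have "filterlim (\<lambda>n. \<bar>e n\<bar>) (at_right 0) sequentially"
    using nz by (simp add: filterlim_at)
  from filterlim_compose[OF ln_at_0 this]
  have bot: "filterlim (\<lambda>n. ln \<bar>e n\<bar>) at_bot sequentially" .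

  have "(\<lambda>n. \<bar>e n\<bar> powr \<sigma>) \<longlonglongrightarrow> 0"
    using \<open>0 < \<sigma>\<close> by (intro tendsto_zero_powrI[OF e0 tendsto_const]) auto
  then have "(\<lambda>n. \<bar>e n\<bar> powr \<sigma>) \<in> o(\<lambda>_. 1)"
    by (intro smalloI_tendsto) auto
  with \<open>\<epsilon> \<in> O(\<lambda>n. \<bar>e n\<bar> powr \<sigma>)\<close> have "\<epsilon> \<in> o(\<lambda>_. 1)"
    by (rule landau_o.big_small_trans)
  from smalloD_tendsto[OF this] have "\<epsilon> \<longlonglongrightarrow> 0"
    by simp
  then have rec: "(\<lambda>n. ln \<bar>e (Suc n)\<bar> - \<rho> * ln \<bar>e n\<bar>) \<longlonglongrightarrow> ln \<bar>C\<bar>"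
    using assms(11) by (intro log_error_recurrence[OF nz \<open>C \<noteq> 0\<close>]) simp_all

  define a where "a n = ln \<bar>e (Suc n) - e n\<bar>" for n
  have "(\<lambda>n. a n - ln \<bar>e n\<bar>) \<longlonglongrightarrow> 0"
    unfolding a_def
    by (rule log_difference_tendsto[OF nz error_ratio_tendsto_0[OF nz \<open>\<rho> > 1\<close> bot rec]])
  then have quot: "(\<lambda>n. a (Suc n) / a n - \<rho>) \<in> O(\<lambda>n. 1 / ln \<bar>e n\<bar>)"
    by (rule quotient_of_perturbed_recurrence[OF bot rec])

  have ACLOC_eq: "ACLOC x n = a (Suc (n - 2)) / a (n - 2)" if "n \<ge> 2" for n
  proof -
    from that obtain m where "n = Suc (Suc m)"
      by (metis Suc_diff_Suc Suc_1 le_Suc_ex add_2_eq_Suc)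
    then show ?thesis
      using \<open>\<And>n. e n = x n - \<alpha>\<close> by (simp add: ACLOC_def ehat_def a_def)
  qed

  define \<delta> where "\<delta> n = ACLOC x n / \<rho> - 1" for n
  have "filterlim (\<lambda>n::nat. n - 2) sequentially sequentially"
    by (rule filterlim_minus_const_nat_at_top)
  from landau_o.big.compose[OF quot this]
  have "(\<lambda>n. a (Suc (n - 2)) / a (n - 2) - \<rho>) \<in> O(\<lambda>n. 1 / ln \<bar>e (n - 2)\<bar>)" .
  moreover have "\<forall>\<^sub>F n in sequentially. \<rho> * \<delta> n = a (Suc (n - 2)) / a (n - 2) - \<rho>"
    using eventually_ge_at_top[of 2]
  proof eventually_elim
    case (elim n)
    then show ?case
      using \<open>\<rho> > 1\<close> by (simp add: \<delta>_def ACLOC_eq field_simps)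
  qed
  ultimately have "(\<lambda>n. \<rho> * \<delta> n) \<in> O(\<lambda>n. 1 / ln \<bar>e (n - 2)\<bar>)"
    by (rule landau_o.big.in_cong[THEN iffD2, rotated])
  then have main: "\<delta> \<in> O(\<lambda>n. 1 / ln \<bar>e (n - 2)\<bar>)"
    using \<open>\<rho> > 1\<close> by simp
  have scaled: "\<delta> \<in> O(\<lambda>n. c / (\<rho> * ln \<bar>e (n - 2)\<bar>))" if "c \<noteq> 0" for c
  proof -
    have "\<delta> \<in> O(\<lambda>n. (c / \<rho>) * (1 / ln \<bar>e (n - 2)\<bar>))"
      using main \<open>\<rho> > 1\<close> that by (subst landau_o.big.cmult) auto
    then show ?thesis
      by simp
  qed
  show ?thesis
  proof (intro exI conjI impI)
    show "\<forall>\<^sub>F n in sequentially. ACLOC x n = \<rho> * (1 + \<delta> n)"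
      using \<open>\<rho> > 1\<close> by (simp add: \<delta>_def)
    show "\<delta> \<in> O(\<lambda>n. ln \<bar>C\<bar> / (\<rho> * ln \<bar>e (n - 2)\<bar>))" if "\<bar>C\<bar> \<noteq> 1"
      using that \<open>C \<noteq> 0\<close> by (intro scaled) simp
    show "\<delta> \<in> O(\<lambda>n. 1 / (\<rho> * ln \<bar>e (n - 2)\<bar>))"
      by (rule scaled) simp
  qed
qed

end
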